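(* Let $X, Y \subseteq \mathbb{R}$ be Cantor sets. Then the set $\mathrm{End}^{\omega}(X,Y)$ of all maps $f : X \to Y$ such that $f(X) = Y$ and $f$ extends to a real-analytic map (into $\mathbb{R}$) on some open interval containing $X$ is at most countable.
   Context: A Cantor set is a non-empty, compact, totally disconnected set with no isolated points. $\mathrm{End}^{\omega}(X,Y)$ is a set of maps $f: X\to Y$ (functions on $X$); the open interval containing $X$ on which the real-analytic extension is defined may depend on $f$. *)

theory Defs
  imports "HOL-Analysis.Analysis"
begin

definition totally_disconnected :: "'a::topological_space set \<Rightarrow> bool" where
  "totally_disconnected X \<longleftrightarrow> (\<forall>x\<in>X. connected_component_set X x = {x})"

definition cantor_set :: "'a::topological_space set \<Rightarrow> bool" where
  "cantor_set X \<longleftrightarrow>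
     X \<noteq> {} \<and> compact X \<and> totally_disconnected X \<and> \<not> (\<exists>x. x isolated_in X)"

text \<open>
  Note that \<open>has_fps_expansion\<close> demands a positive radius of convergence and agreement with the
  sum of the series in a neighbourhood of \<open>0\<close>; it is a local condition on \<open>g\<close> around \<open>a\<close>.
\<close>

definition real_analytic_on :: "(real \<Rightarrow> real) \<Rightarrow> real set \<Rightarrow> bool"
    (infixl "real'_analytic'_on" 50) where
  "g real_analytic_on S \<longleftrightarrow> (\<forall>a\<in>S. \<exists>F. (\<lambda>t. g (a + t)) has_fps_expansion F)"

text \<open>
  Maps on \<open>X\<close> are taken to be extensional (\<open>undefined\<close> outside \<open>X\<close>), so that elements of
  \<open>End_omega X Y\<close> are equal iff they agree on \<open>X\<close>. Bounded and unbounded open intervals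
  are both allowed for \<open>I\<close>.
\<close>

definition End_omega :: "real set \<Rightarrow> real set \<Rightarrow> (real \<Rightarrow> real) set" where
  "End_omega X Y =
     {f \<in> X \<rightarrow>\<^sub>E Y. f ` X = Y \<and>
        (\<exists>I g. open I \<and> is_interval I \<and> X \<subseteq> I \<and> g real_analytic_on I \<and> (\<forall>x\<in>X. g x = f x))}"

end

theory Submission
  imports Defs
begin

text \<open>
  A map in \<open>End_omega X Y\<close> is the restriction of a non-constant analytic function \<open>g\<close>, which has only
  finitely many critical points in \<open>X\<close>. So \<open>X\<close> is, up to finitely many points, a countable union of
  compact pieces on which \<open>g\<close> is a diffeomorphism, and their images cover \<open>Y\<close> up to finitely many
  points. By Baire's theorem one of the images contains a relatively open part of \<open>Y\<close>. Thus \<open>g\<close>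
  restricts to a strictly monotone bijection \<open>X \<inter> {p..q} \<rightarrow> Y \<inter> {r..s}\<close> for some
  rational numbers \<open>p\<close>, \<open>q\<close>, \<open>r\<close>, \<open>s\<close> (\<open>monotone_piece\<close>). There are only countably many choices of the
  numbers and of the sign. Since \<open>g\<close> is determined by its Taylor series at the minimum \<open>a\<close> of
  \<open>X \<inter> {p..q}\<close>, it remains to see that, for fixed choices, only countably many Taylor series occur.

  From now on \<open>X\<close> denotes this piece, and all maps are increasing bijections onto the same set. If
  \<open>f0 < f1\<close> to the right of \<open>a\<close>, then \<open>\<phi> = f1\<^sup>-\<^sup>1 f0\<close> is an order automorphism of \<open>X\<close> that contracts
  towards \<open>a\<close>. It carries gaps of \<open>X\<close> to gaps of \<open>X\<close>, and by bounded distortion the gaps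
  \<open>(u k, v k)\<close> in the orbit of one gap have lengths comparable with \<open>v k - \<phi> (v k)\<close>, that is with
  \<open>(f1 - f0) (v k)\<close> (\<open>shrinking_gaps\<close>). Any other two maps \<open>f2\<close>, \<open>f3\<close> send \<open>(u k, v k)\<close> to gaps of the
  image, so they cannot differ at \<open>v k\<close> by a non-zero amount smaller than the length of these
  gaps. Hence \<open>\<bar>f3 - f2\<bar> (v k)\<close> is bounded below by a fixed multiple of \<open>(f1 - f0) (v k)\<close>. Let \<open>f0\<close>
  and \<open>f1\<close> have the least order of contact \<open>n\<close> at \<open>a\<close>, and divide by \<open>(v k - a) ^ n\<close>: the \<open>n\<close>-th
  Taylor coefficients of any two distinct maps are at least some fixed \<open>\<epsilon> > 0\<close> apart
  (\<open>coefficient_gap\<close>). An uncountable set of reals cannot be separated in this way.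
\<close>

section \<open>Taylor expansions of real functions\<close>

lemma eventually_nhds_shift:
  fixes a :: "'a::real_normed_vector"
  assumes "eventually (\<lambda>t. P (a + t)) (nhds 0)"
  shows "eventually P (nhds a)"
proof -
  have "eventually (\<lambda>t. P (a + t)) (filtermap (\<lambda>x. x - a) (nhds a))"
    using assms by (simp add: filtermap_nhds_shift)
  then show ?thesis by (simp add: eventually_filtermap)
qed

lemma expansion_quotient_tendsto:
  fixes f :: "real \<Rightarrow> real"
  assumes "f has_fps_expansion F" and "n \<le> subdegree F"
  shows "((\<lambda>t. f t / t ^ n) \<longlongrightarrow> fps_nth F n) (at 0)"
proof -
  let ?q = "\<lambda>t. if t = 0 then fps_nth F n else f t / t ^ n"
  have "?q has_fps_expansion fps_shift n F"
    using has_fps_expansion_shift[OF assms refl] .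
  then have "continuous (at 0) ?q"
    by (rule has_fps_expansion_imp_continuous)
  then have "(?q \<longlongrightarrow> fps_nth F n) (at 0)"
    by (simp add: continuous_at)
  then show ?thesis
    by (rule Lim_transform_eventually) (auto simp: eventually_at_filter)
qed

lemma expansion_eventually_nonzero:
  fixes f :: "real \<Rightarrow> real"
  assumes "f has_fps_expansion F" and "F \<noteq> 0"
  shows "eventually (\<lambda>t. f t \<noteq> 0) (at 0)"
proof -
  have "((\<lambda>t. f t / t ^ subdegree F) \<longlongrightarrow> fps_nth F (subdegree F)) (at 0)"
    using assms by (intro expansion_quotient_tendsto) auto
  moreover have "fps_nth F (subdegree F) \<noteq> 0"
    using assms by simp
  ultimately have "eventually (\<lambda>t. f t / t ^ subdegree F \<noteq> 0) (at 0)"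
    by (rule tendsto_imp_eventually_ne)
  then show ?thesis
    by (rule eventually_mono) auto
qed

text \<open>
  The rest of the argument needs only this much regularity near the centre of the expansion: the
  second derivative is bounded on a compact neighbourhood, so the first one is Lipschitz there.
\<close>

lemma expansion_lipschitz_derivative:
  fixes g :: "real \<Rightarrow> real"
  assumes g: "(\<lambda>t. g (a + t)) has_fps_expansion F"
  obtains \<delta> L g' where "0 < \<delta>" "0 \<le> L" "g' a = fps_nth F 1"
    "\<And>x. \<bar>x - a\<bar> \<le> \<delta> \<Longrightarrow> (g has_real_derivative g' x) (at x)"
    "\<And>x y. \<bar>x - a\<bar> \<le> \<delta> \<Longrightarrow> \<bar>y - a\<bar> \<le> \<delta> \<Longrightarrow> \<bar>g' x - g' y\<bar> \<le> L * \<bar>x - y\<bar>"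
proof -
  have pos: "fps_conv_radius F > 0" and ev: "eventually (\<lambda>t. eval_fps F t = g (a + t)) (nhds 0)"
    using g by (auto simp: has_fps_expansion_def)
  obtain r1 where r1: "r1 > 0" "\<And>t. \<bar>t\<bar> < r1 \<Longrightarrow> eval_fps F t = g (a + t)"
    using ev by (auto simp: eventually_nhds_metric dist_real_def)
  obtain r2 where r2: "0 < r2" "ereal r2 < fps_conv_radius F"
    using ereal_dense2[OF pos] by auto
  define \<delta> where "\<delta> = min (r1 / 2) r2"
  have \<delta>: "\<delta> > 0" "\<delta> < r1" "\<delta> \<le> r2"
    using r1(1) r2(1) by (auto simp: \<delta>_def)
  have conv: "ereal \<bar>t\<bar> < fps_conv_radius F" if "\<bar>t\<bar> \<le> \<delta>" for t
    using that \<delta> r2(2) by (meson ereal_less_eq(3) order.trans order_le_less_trans)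
  have rad: "fps_conv_radius F \<le> fps_conv_radius (fps_deriv F)"
    "fps_conv_radius (fps_deriv F) \<le> fps_conv_radius (fps_deriv (fps_deriv F))"
    by (rule fps_conv_radius_deriv)+
  define h where "h = eval_fps (fps_deriv F)"
  define k where "k = eval_fps (fps_deriv (fps_deriv F))"
  have dF: "(eval_fps F has_real_derivative h t) (at t)" if "\<bar>t\<bar> \<le> \<delta>" for t
    unfolding h_def using conv[OF that] by (intro has_field_derivative_eval_fps) auto
  have dh: "(h has_real_derivative k t) (at t)" if "\<bar>t\<bar> \<le> \<delta>" for t
    unfolding h_def k_def using conv[OF that] rad
    by (intro has_field_derivative_eval_fps) (auto intro: order_less_le_trans)
  have "continuous_on {-\<delta>..\<delta>} k"
    unfolding k_def
  proof (rule continuous_on_subset[OF continuous_on_eval_fps], rule subsetI)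
    fix t assume "t \<in> {-\<delta>..\<delta>}"
    then have "ereal \<bar>t\<bar> < fps_conv_radius F"
      by (intro conv) auto
    then show "t \<in> eball 0 (fps_conv_radius (fps_deriv (fps_deriv F)))"
      using rad by (auto intro: order_less_le_trans)
  qed
  then have "bounded (k ` {-\<delta>..\<delta>})"
    by (intro compact_imp_bounded compact_continuous_image) auto
  then obtain L where L: "\<And>t. \<bar>t\<bar> \<le> \<delta> \<Longrightarrow> \<bar>k t\<bar> \<le> L"
    unfolding bounded_iff by (force simp: abs_le_iff)
  have L0: "0 \<le> L" using L[of 0] \<delta> by force
  have lip: "\<bar>h s - h t\<bar> \<le> L * \<bar>s - t\<bar>" if "\<bar>s\<bar> \<le> \<delta>" "\<bar>t\<bar> \<le> \<delta>" for s t
  proof -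
    have "norm (h s - h t) \<le> L * norm (s - t)"
    proof (rule field_differentiable_bound[of "{-\<delta>..\<delta>}" h k])
      show "(h has_real_derivative k z) (at z within {-\<delta>..\<delta>})" if "z \<in> {-\<delta>..\<delta>}" for z
        using dh[of z] that by (auto intro: has_field_derivative_at_within)
      show "norm (k z) \<le> L" if "z \<in> {-\<delta>..\<delta>}" for z
        using L[of z] that by auto
    qed (use that in auto)
    then show ?thesis by simp
  qed
  show thesis
  proof (rule that[of \<delta> L "\<lambda>x. h (x - a)"])
    show "(g has_real_derivative h (x - a)) (at x)" if "\<bar>x - a\<bar> \<le> \<delta>" for x
    proof -
      have "((\<lambda>y. eval_fps F (y - a)) has_real_derivative h (x - a) * 1) (at x)"
        by (rule DERIV_chain2[where f = "eval_fps F" and g = "\<lambda>y. y - a"])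
          (use dF[OF that] in \<open>auto intro!: derivative_eq_intros\<close>)
      moreover have "eventually (\<lambda>y. eval_fps F (y - a) = g y) (nhds x)"
      proof -
        have "eventually (\<lambda>y. y \<in> ball a r1) (nhds x)"
          using that \<delta> by (intro eventually_nhds_in_open) (auto simp: dist_real_def)
        then show ?thesis
        proof (rule eventually_mono)
          fix y assume "y \<in> ball a r1"
          then show "eval_fps F (y - a) = g y"
            using r1(2)[of "y - a"] by (auto simp: dist_real_def abs_minus_commute)
        qed
      qed
      ultimately show ?thesis
        using DERIV_cong_ev[OF refl] by (metis mult.right_neutral)
    qed
    show "\<bar>h (x - a) - h (y - a)\<bar> \<le> L * \<bar>x - y\<bar>" if "\<bar>x - a\<bar> \<le> \<delta>" "\<bar>y - a\<bar> \<le> \<delta>" for x y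
      using lip[OF that] by simp
    show "h (a - a) = fps_nth F 1"
      by (simp add: h_def eval_fps_at_0)
  qed (use \<delta> L0 in auto)
qed

lemma expansion_derivative_bounds:
  fixes g :: "real \<Rightarrow> real"
  assumes g: "(\<lambda>t. g (a + t)) has_fps_expansion F" and m: "m < fps_nth F 1"
  obtains \<delta> L M g' where "0 < \<delta>" "0 \<le> L"
    "\<And>x. \<bar>x - a\<bar> \<le> \<delta> \<Longrightarrow> (g has_real_derivative g' x) (at x)"
    "\<And>x. \<bar>x - a\<bar> \<le> \<delta> \<Longrightarrow> m \<le> g' x"
    "\<And>x. \<bar>x - a\<bar> \<le> \<delta> \<Longrightarrow> g' x \<le> M"
    "\<And>x y. \<bar>x - a\<bar> \<le> \<delta> \<Longrightarrow> \<bar>y - a\<bar> \<le> \<delta> \<Longrightarrow> \<bar>g' x - g' y\<bar> \<le> L * \<bar>x - y\<bar>"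
proof -
  obtain d L g' where *: "0 < d" "0 \<le> L" "g' a = fps_nth F 1"
    "\<And>x. \<bar>x - a\<bar> \<le> d \<Longrightarrow> (g has_real_derivative g' x) (at x)"
    "\<And>x y. \<bar>x - a\<bar> \<le> d \<Longrightarrow> \<bar>y - a\<bar> \<le> d \<Longrightarrow> \<bar>g' x - g' y\<bar> \<le> L * \<bar>x - y\<bar>"
    using expansion_lipschitz_derivative[OF g] by metis
  define e where "e = fps_nth F 1 - m"
  have e: "e > 0" using m by (simp add: e_def)
  define \<delta> where "\<delta> = min d (e / (L + 1))"
  have \<delta>: "0 < \<delta>" "\<delta> \<le> d" using *(1,2) e by (auto simp: \<delta>_def)
  have "\<delta> \<le> e / (L + 1)" by (simp add: \<delta>_def)
  then have "\<delta> * (L + 1) \<le> e" using *(2) by (simp add: field_simps)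
  then have L\<delta>: "L * \<delta> \<le> e" using \<delta>(1) by (simp add: algebra_simps)
  have close: "\<bar>g' x - g' a\<bar> \<le> e" if "\<bar>x - a\<bar> \<le> \<delta>" for x
  proof -
    have "\<bar>g' x - g' a\<bar> \<le> L * \<bar>x - a\<bar>" using that \<delta> *(1) by (intro *(5)) auto
    also have "\<dots> \<le> L * \<delta>" using that *(2) by (intro mult_left_mono)
    finally show ?thesis using L\<delta> by simp
  qed
  show thesis
  proof (rule that[of \<delta> L g' "fps_nth F 1 + e"])
    show "m \<le> g' x" if "\<bar>x - a\<bar> \<le> \<delta>" for x
      using close[OF that] *(3) by (auto simp: e_def abs_le_iff)
    show "g' x \<le> fps_nth F 1 + e" if "\<bar>x - a\<bar> \<le> \<delta>" for x
      using close[OF that] *(3) by (auto simp: abs_le_iff)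
  qed (use \<delta> *(1,2,4,5) in auto)
qed

text \<open>
  The set of points near which the two functions agree is open by its definition. It is closed in
  \<open>I\<close> because a difference with a non-zero expansion has isolated zeros.
\<close>

lemma analytic_identity:
  fixes g h :: "real \<Rightarrow> real"
  assumes I: "connected I" "open I" and g: "g real_analytic_on I" and h: "h real_analytic_on I"
    and a: "a \<in> I" and ev: "eventually (\<lambda>x. g x = h x) (nhds a)" and x: "x \<in> I"
  shows "g x = h x"
proof -
  define S where "S = {z \<in> I. eventually (\<lambda>x. g x = h x) (nhds z)}"
  have "openin (top_of_set I) S"
  proof -
    have "S = I \<inter> {z. eventually (\<lambda>x. g x = h x) (nhds z)}" by (auto simp: S_def)
    moreover have "open {z. eventually (\<lambda>x. g x = h x) (nhds z)}"
      by (subst open_subopen) (simp add: eventually_nhds subset_eq, blast)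
    ultimately show ?thesis by (metis openin_open)
  qed
  moreover have "closedin (top_of_set I) S"
  proof -
    have "z \<in> S" if z: "z \<in> I" "z islimpt S" for z
    proof (rule ccontr)
      assume "z \<notin> S"
      obtain F G where FG: "(\<lambda>t. g (z + t)) has_fps_expansion F" "(\<lambda>t. h (z + t)) has_fps_expansion G"
        using g h z(1) unfolding real_analytic_on_def by blast
      have d: "(\<lambda>t. g (z + t) - h (z + t)) has_fps_expansion F - G"
        using FG by (rule has_fps_expansion_diff)
      have "F - G \<noteq> 0"
      proof
        assume "F - G = 0"
        then have "eventually (\<lambda>t. g (z + t) - h (z + t) = 0) (nhds 0)"
          using d by (auto simp: has_fps_expansion_def elim: eventually_mono)
        then have "eventually (\<lambda>x. g x = h x) (nhds z)"
          by - (rule eventually_nhds_shift, simp)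
        with z \<open>z \<notin> S\<close> show False by (simp add: S_def)
      qed
      from expansion_eventually_nonzero[OF d this]
      have "eventually (\<lambda>x. g x \<noteq> h x) (at z)"
        by (subst at_to_0) (simp add: eventually_filtermap add.commute)
      then obtain T where T: "open T" "z \<in> T" "\<And>x. x \<in> T \<Longrightarrow> x \<noteq> z \<Longrightarrow> g x \<noteq> h x"
        by (auto simp: eventually_at_topological)
      then obtain y where "y \<in> S" "y \<in> T" "y \<noteq> z"
        using z(2) by (auto simp: islimpt_def)
      then show False
        using T(3) eventually_nhds_x_imp_x by (auto simp: S_def)
    qed
    then show ?thesis
      by (auto simp: closedin_limpt S_def)
  qed
  moreover have "a \<in> S" using a ev by (simp add: S_def)
  ultimately have "S = I"
    using I(1) by (auto simp: connected_clopen)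
  then show ?thesis
    using x eventually_nhds_x_imp_x by (auto simp: S_def)
qed

section \<open>Bounded distortion\<close>

text \<open>
  Think of \<open>v\<close> and \<open>u\<close> as orbits of the contraction \<open>\<phi> = f1\<^sup>-\<^sup>1 f0\<close>. The ratio of the gap \<open>(u k, v k)\<close>
  to the fundamental interval \<open>(v (Suc k), v k)\<close> that contains it changes in each step by a factor
  that differs from \<open>1\<close> by at most a multiple of the lengths of two fundamental intervals. These
  lengths add up to at most \<open>\<delta>\<close>, so for small \<open>\<delta>\<close> the ratio never falls below half its initial
  value.
\<close>

lemma bounded_distortion:
  fixes u v :: "nat \<Rightarrow> real"
  assumes d0: "\<And>x. \<bar>x - a\<bar> \<le> \<delta> \<Longrightarrow> (f0 has_real_derivative d0 x) (at x)"
    and d1: "\<And>x. \<bar>x - a\<bar> \<le> \<delta> \<Longrightarrow> (f1 has_real_derivative d1 x) (at x)"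
    and m: "0 < m" "\<And>x. \<bar>x - a\<bar> \<le> \<delta> \<Longrightarrow> m \<le> d0 x" "\<And>x. \<bar>x - a\<bar> \<le> \<delta> \<Longrightarrow> m \<le> d1 x"
    and L: "0 \<le> L"
      "\<And>x y. \<bar>x - a\<bar> \<le> \<delta> \<Longrightarrow> \<bar>y - a\<bar> \<le> \<delta> \<Longrightarrow> \<bar>d0 x - d0 y\<bar> \<le> L * \<bar>x - y\<bar>"
      "\<And>x y. \<bar>x - a\<bar> \<le> \<delta> \<Longrightarrow> \<bar>y - a\<bar> \<le> \<delta> \<Longrightarrow> \<bar>d1 x - d1 y\<bar> \<le> L * \<bar>x - y\<bar>"
    and small: "4 * L * \<delta> \<le> m"
    and uv: "\<And>k. a \<le> v k" "\<And>k. v k \<le> a + \<delta>" "\<And>k. v (Suc k) \<le> u k" "\<And>k. u k < v k"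
    and v: "\<And>k. f1 (v (Suc k)) = f0 (v k)" and u: "\<And>k. f1 (u (Suc k)) = f0 (u k)"
  shows "(v 0 - u 0) / (v 0 - v 1) * (v k - v (Suc k)) \<le> 2 * (v k - u k)"
proof -
  define A where "A = (\<lambda>k. v k - u k)"
  define B where "B = (\<lambda>k. v k - v (Suc k))"
  define c where "c = L / m"
  have c0: "0 \<le> c" using L(1) m(1) by (simp add: c_def)
  have cm: "c * m = L" using m(1) by (simp add: c_def)
  have A: "0 < A k" for k using uv(4) by (simp add: A_def)
  have B: "0 < B k" for k using uv(3)[of k] uv(4)[of k] by (simp add: B_def)
  have in_range: "\<bar>x - a\<bar> \<le> \<delta>" if "v (Suc k) \<le> x" "x \<le> v k" for x k
    using that uv(1)[of "Suc k"] uv(2)[of k] by auto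
  \<comment> \<open>A Lipschitz function bounded below by \<open>m\<close> varies on the \<open>k\<close>-th fundamental interval by at most
      the factor \<open>1 - L / m * B k\<close>.\<close>
  have rel: "d y * (1 - c * B k) \<le> d x"
    if d: "d = d0 \<or> d = d1" and x: "v (Suc k) \<le> x" "x \<le> v k" and y: "v (Suc k) \<le> y" "y \<le> v k"
    for d x y k
  proof -
    have "\<bar>x - a\<bar> \<le> \<delta>" "\<bar>y - a\<bar> \<le> \<delta>" using x y by (auto intro: in_range)
    then have my: "m \<le> d y" and "\<bar>d x - d y\<bar> \<le> L * \<bar>x - y\<bar>"
      using d m(2,3) L(2,3) by metis+
    note this(2)
    also have "L * \<bar>x - y\<bar> \<le> L * B k" using x y L(1) by (intro mult_left_mono) (auto simp: B_def)
    also have "\<dots> = c * B k * m" using cm by (metis mult.assoc mult.commute)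
    also have "\<dots> \<le> c * B k * d y" using my c0 B[of k] by (intro mult_left_mono) auto
    finally show ?thesis by (simp add: algebra_simps abs_le_iff)
  qed
  have \<delta>0: "0 \<le> \<delta>" using uv(1,2)[of 0] by linarith
  have c\<delta>: "4 * (c * \<delta>) \<le> 1"
    using small m(1) by (simp add: c_def field_simps)
  have Bsmall: "c * B k \<le> 1 / 4" for k
  proof -
    have "B k \<le> \<delta>" using uv(1)[of "Suc k"] uv(2)[of k] by (auto simp: B_def)
    then have "c * B k \<le> c * \<delta>" using c0 by (rule mult_left_mono)
    then show ?thesis using c\<delta> by simp
  qed
  \<comment> \<open>Both lengths are transported by the mean value theorem for \<open>f0\<close> and for \<open>f1\<close>; the four mean
      value points lie in the \<open>k\<close>-th and the next fundamental interval, where the derivatives are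
      almost constant.\<close>
  have step: "(1 - c * B k) * (1 - c * B (Suc k)) * (A k * B (Suc k)) \<le> A (Suc k) * B k" for k
  proof -
    have r: "\<bar>x - a\<bar> \<le> \<delta>" if "v (Suc (Suc k)) \<le> x" "x \<le> v k" for x
      using that uv(1)[of "Suc (Suc k)"] uv(2)[of k] by auto
    have o: "v (Suc (Suc k)) < v (Suc k)" "v (Suc k) < v k" using B[of k] B[of "Suc k"] by (auto simp: B_def)
    have "\<exists>x. u k < x \<and> x < v k \<and> f0 (v k) - f0 (u k) = (v k - u k) * d0 x"
      using uv(3)[of k] uv(4)[of k] o by (intro MVT2 d0 r) auto
    then obtain x where x: "u k < x" "x < v k" "f0 (v k) - f0 (u k) = A k * d0 x"
      by (auto simp: A_def)
    have "\<exists>x. v (Suc k) < x \<and> x < v k \<and> f0 (v k) - f0 (v (Suc k)) = (v k - v (Suc k)) * d0 x"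
      using o by (intro MVT2 d0 r) auto
    then obtain x' where x': "v (Suc k) < x'" "x' < v k" "f0 (v k) - f0 (v (Suc k)) = B k * d0 x'"
      by (auto simp: B_def)
    have "\<exists>x. u (Suc k) < x \<and> x < v (Suc k) \<and> f1 (v (Suc k)) - f1 (u (Suc k)) = (v (Suc k) - u (Suc k)) * d1 x"
      using uv(3)[of "Suc k"] uv(4)[of "Suc k"] o by (intro MVT2 d1 r) auto
    then obtain z where z: "u (Suc k) < z" "z < v (Suc k)" "f1 (v (Suc k)) - f1 (u (Suc k)) = A (Suc k) * d1 z"
      by (auto simp: A_def)
    have "\<exists>x. v (Suc (Suc k)) < x \<and> x < v (Suc k) \<and> f1 (v (Suc k)) - f1 (v (Suc (Suc k))) = (v (Suc k) - v (Suc (Suc k))) * d1 x"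
      using o by (intro MVT2 d1 r) auto
    then obtain z' where z': "v (Suc (Suc k)) < z'" "z' < v (Suc k)" "f1 (v (Suc k)) - f1 (v (Suc (Suc k))) = B (Suc k) * d1 z'"
      by (auto simp: B_def)
    have eA: "A k * d0 x = A (Suc k) * d1 z" using x(3) z(3) v u by simp
    have eB: "B k * d0 x' = B (Suc k) * d1 z'" using x'(3) z'(3) v by simp
    have zpos: "0 < d1 z" using m(3)[of z] m(1) r[of z] uv(3)[of "Suc k"] z o by force
    have "d1 z * ((1 - c * B k) * (1 - c * B (Suc k)) * (A k * B (Suc k)))
        = (1 - c * B k) * A k * B (Suc k) * (d1 z * (1 - c * B (Suc k)))"
      by (simp add: ac_simps)
    also have "\<dots> \<le> (1 - c * B k) * A k * B (Suc k) * d1 z'"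
      using A[of k] B[of "Suc k"] Bsmall[of k] z z' uv(3)[of "Suc k"]
      by (intro mult_left_mono rel) auto
    also have "\<dots> = A k * B k * (d0 x' * (1 - c * B k))"
      using eB by (metis (no_types, opaque_lifting) mult.assoc mult.commute)
    also have "\<dots> \<le> A k * B k * d0 x"
      using A[of k] B[of k] x x' uv(3)[of k]
      by (intro mult_left_mono rel) auto
    also have "\<dots> = d1 z * (A (Suc k) * B k)"
      using eA by (metis (no_types, opaque_lifting) mult.assoc mult.commute)
    finally show ?thesis
      using zpos by (simp add: mult_le_cancel_left_pos)
  qed
  \<comment> \<open>The fundamental intervals are disjoint, so the product of the factors \<open>1 - c * B j\<close> is at least
      one minus their telescoping sum. Each interval enters two steps, which gives the two
      telescoping sums in \<open>s\<close>.\<close>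
  define s where "s = (\<lambda>k. 1 - c * (v 0 + v 1 - v k - v (Suc k)))"
  have mono: "v k \<le> v 0" for k
    by (induction k) (use B in \<open>auto simp: B_def intro: order.trans less_imp_le\<close>)
  have s: "1 / 2 \<le> s k" "s k \<le> 1" for k
  proof -
    have "v (Suc k) \<le> v 1"
      by (induction k) (use B in \<open>auto simp: B_def intro: order.trans less_imp_le\<close>)
    then show "s k \<le> 1" using c0 mono[of k] by (simp add: s_def)
    have "v 0 + v 1 - v k - v (Suc k) \<le> 2 * \<delta>"
      using uv(1)[of k] uv(1)[of "Suc k"] uv(2)[of 0] uv(2)[of 1] by linarith
    then have "c * (v 0 + v 1 - v k - v (Suc k)) \<le> c * (2 * \<delta>)" using c0 by (rule mult_left_mono)
    then show "1 / 2 \<le> s k" using c\<delta> by (simp add: s_def)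
  qed
  define q where "q = A 0 / B 0"
  have q: "0 < q" using A B by (simp add: q_def)
  have main: "q * s k * B k \<le> A k" for k
  proof (induction k)
    case 0
    show ?case using B[of 0] by (simp add: q_def s_def)
  next
    case (Suc k)
    define x y where "x = c * B k" and "y = c * B (Suc k)"
    have xy: "0 \<le> x" "0 \<le> y" "x \<le> 1/4" "y \<le> 1/4"
      using c0 B[of k] B[of "Suc k"] Bsmall[of k] Bsmall[of "Suc k"] by (auto simp: x_def y_def)
    have "s (Suc k) = s k - x - y" by (simp add: s_def x_def y_def B_def algebra_simps)
    also have "\<dots> \<le> (1 - x) * (1 - y) * s k"
    proof -
      have "(1 - x) * (1 - y) * s k = s k - (x + y) * s k + x * y * s k" by (simp add: algebra_simps)
      moreover have "(x + y) * s k \<le> x + y"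
        using s(2)[of k] xy mult_left_mono[of "s k" 1 "x + y"] by simp
      moreover have "0 \<le> x * y * s k" using xy s(1)[of k] by simp
      ultimately show ?thesis by linarith
    qed
    finally have ss: "s (Suc k) \<le> (1 - x) * (1 - y) * s k" .
    have "B k * (q * s (Suc k) * B (Suc k)) \<le> B k * (q * ((1 - x) * (1 - y) * s k) * B (Suc k))"
      using ss q B[of k] B[of "Suc k"] by (intro mult_left_mono mult_right_mono) auto
    also have "\<dots> = (1 - x) * (1 - y) * ((q * s k * B k) * B (Suc k))"
      by (simp add: ac_simps)
    also have "\<dots> \<le> (1 - x) * (1 - y) * (A k * B (Suc k))"
      using Suc xy B[of "Suc k"] by (intro mult_left_mono mult_right_mono) auto
    also have "\<dots> \<le> B k * A (Suc k)"
      using step[of k] by (simp add: x_def y_def mult.commute)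
    finally show ?case
      using B[of k] by (simp add: mult_le_cancel_left_pos)
  qed
  have "q * (1 / 2) * B k \<le> q * s k * B k"
    using s(1)[of k] q B[of k] by (intro mult_left_mono mult_right_mono) auto
  also note main[of k]
  finally have "q * B k \<le> 2 * A k" by simp
  then show ?thesis
    by (simp add: q_def A_def B_def)
qed

section \<open>Gaps shrinking to the minimum\<close>

lemma gap_below:
  fixes X :: "real set"
  assumes X: "closed X" and a: "a \<in> X" "a islimpt X" "\<And>x. x \<in> X \<Longrightarrow> a \<le> x"
    and no_interval: "\<And>c. a < c \<Longrightarrow> \<not> {a..c} \<subseteq> X" and "0 < \<delta>"
  obtains u v where "u \<in> X" "v \<in> X" "u < v" "v \<le> a + \<delta>" "{u<..<v} \<inter> X = {}"
proof -
  obtain w where w: "w \<in> X" "w \<noteq> a" "dist w a < \<delta>"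
    using a(2) \<open>0 < \<delta>\<close> by (auto simp: islimpt_approachable)
  have w': "a < w" "w \<le> a + \<delta>" using w a(3)[OF w(1)] by (auto simp: dist_real_def)
  obtain z where z: "a \<le> z" "z \<le> w" "z \<notin> X"
    using no_interval[OF w'(1)] by (auto simp: subset_eq)
  have "compact (X \<inter> {a..z})" "compact (X \<inter> {z..w})"
    using X by (auto intro: closed_Int_compact)
  moreover have "a \<in> X \<inter> {a..z}" "w \<in> X \<inter> {z..w}" using a w z by auto
  ultimately obtain u v where u: "u \<in> X \<inter> {a..z}" "\<And>x. x \<in> X \<inter> {a..z} \<Longrightarrow> x \<le> u"
    and v: "v \<in> X \<inter> {z..w}" "\<And>x. x \<in> X \<inter> {z..w} \<Longrightarrow> v \<le> x"
    using compact_attains_sup[of "X \<inter> {a..z}"] compact_attains_inf[of "X \<inter> {z..w}"] by blast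
  show thesis
  proof (rule that[of u v])
    show "u \<in> X" "v \<in> X" using u v by auto
    have "u \<noteq> z" "v \<noteq> z" using u v z by auto
    then show "u < v" using u(1) v(1) by auto
    show "v \<le> a + \<delta>" using v w' by auto
    show "{u<..<v} \<inter> X = {}"
    proof -
      have False if x: "x \<in> X" "u < x" "x < v" for x
        using u(2)[of x] v(2)[of x] u(1) v(1) x by (cases "x \<le> z") auto
      then show ?thesis by auto
    qed
  qed
qed

text \<open>
  The gaps are the images of one gap under the iterates of \<open>\<phi> = f1\<^sup>-\<^sup>1 f0\<close>. They converge to \<open>a\<close>, as the
  limit of an orbit is a point where \<open>f0\<close> and \<open>f1\<close> agree. The inequality holds because \<open>f1 - f0\<close> at
  \<open>v k\<close> is the increment of \<open>f1\<close> over \<open>(v (Suc k), v k)\<close>, and bounded distortion compares this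
  interval with the gap.
\<close>

lemma shrinking_gaps:
  fixes X :: "real set"
  assumes X: "closed X" and a: "a \<in> X" "a islimpt X" "\<And>x. x \<in> X \<Longrightarrow> a \<le> x"
    and no_interval: "\<And>c. a < c \<Longrightarrow> \<not> {a..c} \<subseteq> X"
    and mono: "strict_mono_on X f0" "strict_mono_on X f1" and img: "f0 ` X = f1 ` X"
    and F0: "(\<lambda>t. f0 (a + t)) has_fps_expansion F0" "0 < fps_nth F0 1"
    and F1: "(\<lambda>t. f1 (a + t)) has_fps_expansion F1" "0 < fps_nth F1 1"
    and pos: "0 < fps_nth (F1 - F0) (subdegree (F1 - F0))"
  obtains u v \<kappa> where "0 < \<kappa>" "v \<longlonglongrightarrow> a" "\<And>k. a < v k"
    "\<And>k. u k \<in> X" "\<And>k. v k \<in> X" "\<And>k. u k < v k" "\<And>k. {u k<..<v k} \<inter> X = {}"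
    "\<And>k. \<kappa> * \<bar>f1 (v k) - f0 (v k)\<bar> \<le> v k - u k"
proof -
  define m where "m = min (fps_nth F0 1) (fps_nth F1 1) / 2"
  have m: "0 < m" "m < fps_nth F0 1" "m < fps_nth F1 1"
    using F0(2) F1(2) by (auto simp: m_def)
  obtain \<delta>0 L0 M0 d0 where d0: "0 < \<delta>0" "0 \<le> L0"
    "\<And>x. \<bar>x - a\<bar> \<le> \<delta>0 \<Longrightarrow> (f0 has_real_derivative d0 x) (at x)"
    "\<And>x. \<bar>x - a\<bar> \<le> \<delta>0 \<Longrightarrow> m \<le> d0 x"
    "\<And>x. \<bar>x - a\<bar> \<le> \<delta>0 \<Longrightarrow> d0 x \<le> M0"
    "\<And>x y. \<bar>x - a\<bar> \<le> \<delta>0 \<Longrightarrow> \<bar>y - a\<bar> \<le> \<delta>0 \<Longrightarrow> \<bar>d0 x - d0 y\<bar> \<le> L0 * \<bar>x - y\<bar>"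
    using expansion_derivative_bounds[OF F0(1) m(2)] by metis
  obtain \<delta>1 L1 M d1 where d1: "0 < \<delta>1" "0 \<le> L1"
    "\<And>x. \<bar>x - a\<bar> \<le> \<delta>1 \<Longrightarrow> (f1 has_real_derivative d1 x) (at x)"
    "\<And>x. \<bar>x - a\<bar> \<le> \<delta>1 \<Longrightarrow> m \<le> d1 x"
    "\<And>x. \<bar>x - a\<bar> \<le> \<delta>1 \<Longrightarrow> d1 x \<le> M"
    "\<And>x y. \<bar>x - a\<bar> \<le> \<delta>1 \<Longrightarrow> \<bar>y - a\<bar> \<le> \<delta>1 \<Longrightarrow> \<bar>d1 x - d1 y\<bar> \<le> L1 * \<bar>x - y\<bar>"
    using expansion_derivative_bounds[OF F1(1) m(3)] by metis
  have "eventually (\<lambda>t. 0 < (f1 (a + t) - f0 (a + t)) / t ^ subdegree (F1 - F0)) (at 0)"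
    using expansion_quotient_tendsto[OF has_fps_expansion_diff[OF F1(1) F0(1)] order.refl] pos
    by (rule order_tendstoD)
  then obtain \<delta>2 where \<delta>2: "0 < \<delta>2"
    "\<And>t. t \<noteq> 0 \<Longrightarrow> \<bar>t\<bar> < \<delta>2 \<Longrightarrow> 0 < (f1 (a + t) - f0 (a + t)) / t ^ subdegree (F1 - F0)"
    by (auto simp: eventually_at dist_real_def)
  have less: "f0 x < f1 x" if "a < x" "x < a + \<delta>2" for x
    using \<delta>2(2)[of "x - a"] that by (simp add: zero_less_divide_iff zero_less_power not_less)
  define L where "L = max L0 L1"
  define \<delta> where "\<delta> = min (min \<delta>0 \<delta>1) (min (\<delta>2 / 2) (m / (4 * (L + 1))))"
  have L: "0 \<le> L" "L0 \<le> L" "L1 \<le> L" using d0(2) by (auto simp: L_def)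
  have \<delta>: "0 < \<delta>" "\<delta> \<le> \<delta>0" "\<delta> \<le> \<delta>1" "\<delta> < \<delta>2" "\<delta> \<le> m / (4 * (L + 1))"
  proof -
    have "0 < m / (4 * (L + 1))" using m(1) L(1) by simp
    then show "0 < \<delta>" using d0(1) d1(1) \<delta>2(1) by (simp add: \<delta>_def)
    show "\<delta> \<le> \<delta>0" "\<delta> \<le> \<delta>1" "\<delta> \<le> m / (4 * (L + 1))" by (simp_all add: \<delta>_def)
    have "\<delta> \<le> \<delta>2 / 2" unfolding \<delta>_def by linarith
    then show "\<delta> < \<delta>2" using \<delta>2(1) by simp
  qed
  have small: "4 * L * \<delta> \<le> m"
  proof -
    have "\<delta> * (4 * (L + 1)) \<le> m" using \<delta>(5) L(1) by (simp add: pos_le_divide_eq)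
    then show ?thesis using \<delta>(1) by (simp add: algebra_simps)
  qed
  obtain u0 v0 where uv0: "u0 \<in> X" "v0 \<in> X" "u0 < v0" "v0 \<le> a + \<delta>" "{u0<..<v0} \<inter> X = {}"
    using gap_below[OF X a no_interval \<delta>(1)] by metis
  define \<phi> where "\<phi> = (\<lambda>x. inv_into X f1 (f0 x))"
  have \<phi>: "\<phi> x \<in> X" "f1 (\<phi> x) = f0 x" if "x \<in> X" for x
  proof -
    have "f0 x \<in> f1 ` X" using that img by auto
    then show "\<phi> x \<in> X" "f1 (\<phi> x) = f0 x"
      unfolding \<phi>_def by (auto intro: inv_into_into f_inv_into_f)
  qed
  have \<phi>_less: "\<phi> x < \<phi> y \<longleftrightarrow> x < y" if "x \<in> X" "y \<in> X" for x y
    using that \<phi> strict_mono_on_less[OF mono(1)] strict_mono_on_less[OF mono(2)] by metis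
  have \<phi>_surj: "\<exists>z\<in>X. w = \<phi> z" if "w \<in> X" for w
  proof -
    have "f1 w \<in> f0 ` X" using that by (simp add: img)
    then obtain z where z: "z \<in> X" "f1 w = f0 z" by blast
    then have "f1 w = f1 (\<phi> z)" using \<phi> by simp
    then show ?thesis
      using z that \<phi>(1) strict_mono_on_eqD[OF mono(2)] by metis
  qed
  have \<phi>_down: "\<phi> x < x" if "x \<in> X" "a < x" "x \<le> a + \<delta>" for x
  proof -
    have "f1 (\<phi> x) < f1 x" using less[of x] that \<phi>(2) \<delta> by auto
    then show ?thesis using that \<phi>(1) strict_mono_on_less[OF mono(2)] by blast
  qed
  define u v where "u = (\<lambda>k. (\<phi> ^^ k) u0)" and "v = (\<lambda>k. (\<phi> ^^ k) v0)"
  have iter: "u (Suc k) = \<phi> (u k)" "v (Suc k) = \<phi> (v k)" for k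
    by (simp_all add: u_def v_def)
  have invs: "u k \<in> X \<and> v k \<in> X \<and> u k < v k \<and> {u k<..<v k} \<inter> X = {} \<and> v k \<le> a + \<delta>" for k
  proof (induction k)
    case 0
    then show ?case using uv0 by (simp add: u_def v_def)
  next
    case (Suc k)
    then have k: "u k \<in> X" "v k \<in> X" "u k < v k" "{u k<..<v k} \<inter> X = {}" "v k \<le> a + \<delta>" by auto
    have "a < v k" using a(3)[OF k(1)] k(3) by simp
    then have "\<phi> (v k) < v k" using \<phi>_down k by simp
    moreover have "\<phi> (u k) < \<phi> (v k)" using \<phi>_less k by simp
    moreover have "{\<phi> (u k)<..<\<phi> (v k)} \<inter> X = {}"
    proof -
      have False if w: "w \<in> X" "\<phi> (u k) < w" "w < \<phi> (v k)" for w
      proof -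
        obtain z where z: "z \<in> X" "w = \<phi> z" using \<phi>_surj[OF w(1)] by blast
        then have "u k < z" "z < v k" using w \<phi>_less k(1,2) by simp_all
        then show False using z(1) k(4) by auto
      qed
      then show ?thesis by auto
    qed
    ultimately show ?case using k \<phi>(1) unfolding iter by simp
  qed
  have inv: "u k \<in> X" "v k \<in> X" "u k < v k" "{u k<..<v k} \<inter> X = {}" "v k \<le> a + \<delta>" for k
    using invs[of k] by blast+
  have av: "a < v k" for k using a(3)[OF inv(1)[of k]] inv(3)[of k] by linarith
  \<comment> \<open>A gap and its image do not overlap, because \<open>\<phi> (v k)\<close> is a point of \<open>X\<close> below \<open>v k\<close> and outside
      the gap.\<close>
  have down: "v (Suc k) \<le> u k" for k
  proof (rule ccontr)
    assume "\<not> v (Suc k) \<le> u k"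
    moreover have "v (Suc k) < v k" using \<phi>_down[OF inv(2) av inv(5)] iter(2) by simp
    ultimately have "v (Suc k) \<in> {u k<..<v k} \<inter> X" using inv(2)[of "Suc k"] by simp
    then show False using inv(4)[of k] by blast
  qed
  have f_Suc: "f1 (u (Suc k)) = f0 (u k)" "f1 (v (Suc k)) = f0 (v k)" for k
    using \<phi>(2) inv(1,2)[of k] by (auto simp: iter)
  have "v \<longlonglongrightarrow> a"
  proof -
    have "decseq v"
      using down inv(3) by (intro decseq_SucI) (meson less_imp_le order.trans)
    then obtain l where l: "v \<longlonglongrightarrow> l"
      using decseq_convergent[of v a] av less_imp_le by metis
    have "a \<le> l" by (rule LIMSEQ_le_const[OF l]) (use av less_imp_le in blast)
    moreover have l2: "l \<le> a + \<delta>" by (rule LIMSEQ_le_const2[OF l]) (use inv(5) in blast)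
    moreover have "l = a" if "a < l"
    proof -
      have "isCont f0 l" "isCont f1 l"
        using d0(3)[of l] d1(3)[of l] that l2 \<delta> by (auto intro: DERIV_isCont)
      then have "(\<lambda>k. f0 (v k)) \<longlonglongrightarrow> f0 l" "(\<lambda>k. f1 (v (Suc k))) \<longlonglongrightarrow> f1 l"
        using l by (auto intro: isCont_tendsto_compose LIMSEQ_Suc)
      then have "f0 l = f1 l" unfolding f_Suc by (rule LIMSEQ_unique)
      then show ?thesis using less[of l] that l2 \<delta> by auto
    qed
    ultimately show ?thesis using l by (cases "a < l") auto
  qed
  define q where "q = (v 0 - u 0) / (v 0 - v 1)"
  have q: "0 < q" using inv(3)[of 0] down[of 0] by (simp add: q_def)
  have dist: "q * (v k - v (Suc k)) \<le> 2 * (v k - u k)" for k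
    unfolding q_def
  proof (rule bounded_distortion[where ?f0.0 = f0 and ?f1.0 = f1 and a = a and \<delta> = \<delta> and L = L and m = m and ?d0.0 = d0 and ?d1.0 = d1])
    have "L0 * \<bar>x - y\<bar> \<le> L * \<bar>x - y\<bar>" "L1 * \<bar>x - y\<bar> \<le> L * \<bar>x - y\<bar>" for x y
      using L by (auto intro: mult_right_mono)
    then show "\<bar>d0 x - d0 y\<bar> \<le> L * \<bar>x - y\<bar>" "\<bar>d1 x - d1 y\<bar> \<le> L * \<bar>x - y\<bar>"
      if "\<bar>x - a\<bar> \<le> \<delta>" "\<bar>y - a\<bar> \<le> \<delta>" for x y
      using d0(6)[of x y] d1(6)[of x y] that \<delta> by (meson order.trans)+
  qed (use d0(3,4) d1(3,4) m(1) L(1) small inv(3,5) down f_Suc av \<delta>(2,3) in \<open>auto intro: less_imp_le\<close>)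
  have M: "0 < M" using m(1) d1(4)[of a] d1(5)[of a] d1(1) by auto
  have "q / (2 * M) * \<bar>f1 (v k) - f0 (v k)\<bar> \<le> v k - u k" for k
  proof -
    have lt: "v (Suc k) < v k" using down[of k] inv(3)[of k] by linarith
    have r: "\<bar>x - a\<bar> \<le> \<delta>1" if "v (Suc k) \<le> x" "x \<le> v k" for x
      using that av[of "Suc k"] inv(5)[of k] \<delta> by auto
    have "\<exists>x. v (Suc k) < x \<and> x < v k \<and> f1 (v k) - f1 (v (Suc k)) = (v k - v (Suc k)) * d1 x"
      using lt by (intro MVT2 d1 r) auto
    then obtain x where x: "v (Suc k) < x" "x < v k" "f1 (v k) - f1 (v (Suc k)) = (v k - v (Suc k)) * d1 x"
      by auto
    have "f0 (v k) < f1 (v k)" using less av[of k] inv(5)[of k] \<delta> by auto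
    then have "\<bar>f1 (v k) - f0 (v k)\<bar> = (v k - v (Suc k)) * d1 x"
      using x(3) f_Suc(2)[of k] by simp
    also have "\<dots> \<le> (v k - v (Suc k)) * M"
      using lt x r by (intro mult_left_mono d1(5)) auto
    finally have "q / (2 * M) * \<bar>f1 (v k) - f0 (v k)\<bar> \<le> q / (2 * M) * ((v k - v (Suc k)) * M)"
      using q M by (intro mult_left_mono) auto
    also have "\<dots> = q * (v k - v (Suc k)) / 2" using M by simp
    also have "\<dots> \<le> v k - u k" using dist[of k] by simp
    finally show ?thesis .
  qed
  then show thesis
    using that[of "q / (2 * M)" v u] q M \<open>v \<longlonglongrightarrow> a\<close> av inv by simp
qed

section \<open>Separation of Taylor coefficients\<close>

text \<open>
  An order isomorphism sends the gap \<open>(u, v)\<close> of \<open>X\<close> to the gap \<open>(f u, f v)\<close> of the common image, and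
  \<open>h v\<close> is a point of that image.
\<close>

lemma gap_separates_images:
  fixes X :: "real set" and f h :: "real \<Rightarrow> real"
  assumes f: "strict_mono_on X f" and img: "h ` X = f ` X"
    and uv: "u \<in> X" "v \<in> X" "{u<..<v} \<inter> X = {}" and less: "h v < f v"
  shows "h v \<le> f u"
proof -
  have "h v \<in> f ` X" using uv(2) by (simp add: img[symmetric])
  then obtain w where w: "w \<in> X" "h v = f w" by blast
  then have "w < v" using less uv strict_mono_on_less[OF f] by simp
  then have "w \<le> u" using w uv by force
  then show ?thesis using w uv strict_mono_on_leD[OF f] by simp
qed

text \<open>
  The bound \<open>\<epsilon>\<close> depends on \<open>f0\<close>, \<open>f1\<close> and \<open>m\<close> but is the same for all \<open>f2\<close> and \<open>f3\<close>. The lower bound \<open>m\<close> for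
  their derivatives at \<open>a\<close> is what makes the gaps of the image uniformly comparable with those of
  \<open>X\<close>.
\<close>

lemma coefficient_gap:
  fixes X :: "real set"
  assumes X: "closed X" and a: "a \<in> X" "a islimpt X" "\<And>x. x \<in> X \<Longrightarrow> a \<le> x"
    and no_interval: "\<And>c. a < c \<Longrightarrow> \<not> {a..c} \<subseteq> X"
    and mono: "strict_mono_on X f0" "strict_mono_on X f1" and img: "f0 ` X = Y" "f1 ` X = Y"
    and F0: "(\<lambda>t. f0 (a + t)) has_fps_expansion F0" "0 < fps_nth F0 1"
    and F1: "(\<lambda>t. f1 (a + t)) has_fps_expansion F1" "0 < fps_nth F1 1"
    and pos: "0 < fps_nth (F1 - F0) n" and n: "n = subdegree (F1 - F0)" and m: "0 < m"
  obtains \<epsilon> where "0 < \<epsilon>"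
    "\<And>f2 f3 F2 F3. \<lbrakk>strict_mono_on X f2; strict_mono_on X f3; f2 ` X = Y; f3 ` X = Y;
      (\<lambda>t. f2 (a + t)) has_fps_expansion F2; m < fps_nth F2 1;
      (\<lambda>t. f3 (a + t)) has_fps_expansion F3; m < fps_nth F3 1;
      F2 \<noteq> F3; n \<le> subdegree (F3 - F2)\<rbrakk> \<Longrightarrow> \<epsilon> \<le> \<bar>fps_nth F3 n - fps_nth F2 n\<bar>"
proof -
  obtain u v \<kappa> where \<kappa>: "0 < \<kappa>" and va: "v \<longlonglongrightarrow> a" "\<And>k. a < v k"
    and uv: "\<And>k. u k \<in> X" "\<And>k. v k \<in> X" "\<And>k. u k < v k" "\<And>k. {u k<..<v k} \<inter> X = {}"
    and le: "\<And>k. \<kappa> * \<bar>f1 (v k) - f0 (v k)\<bar> \<le> v k - u k"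
    using shrinking_gaps[OF X a no_interval mono _ F0 F1] pos n img by metis
  have v0: "filterlim (\<lambda>k. v k - a) (at 0) sequentially"
  proof -
    have "(\<lambda>k. v k - a) \<longlonglongrightarrow> 0" using tendsto_diff[OF va(1) tendsto_const[of a]] by simp
    moreover have "v k - a \<noteq> 0" for k using va(2)[of k] by simp
    ultimately show ?thesis by (simp add: filterlim_at)
  qed
  show thesis
  proof (rule that[of "m * \<kappa> * fps_nth (F1 - F0) n"])
    show "0 < m * \<kappa> * fps_nth (F1 - F0) n" using m \<kappa> pos by (intro mult_pos_pos)
    fix f2 f3 F2 F3
    assume f: "strict_mono_on X f2" "strict_mono_on X f3" "f2 ` X = Y" "f3 ` X = Y"
      and F2: "(\<lambda>t. f2 (a + t)) has_fps_expansion F2" "m < fps_nth F2 1"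
      and F3: "(\<lambda>t. f3 (a + t)) has_fps_expansion F3" "m < fps_nth F3 1"
      and ne: "F2 \<noteq> F3" and sub: "n \<le> subdegree (F3 - F2)"
    have growth: "eventually (\<lambda>k. m * (v k - u k) \<le> f (v k) - f (u k)) sequentially"
      if F: "(\<lambda>t. f (a + t)) has_fps_expansion F" "m < fps_nth F 1" for f F
    proof -
      obtain \<delta> L M d where d: "0 < \<delta>" "0 \<le> L"
        "\<And>x. \<bar>x - a\<bar> \<le> \<delta> \<Longrightarrow> (f has_real_derivative d x) (at x)"
        "\<And>x. \<bar>x - a\<bar> \<le> \<delta> \<Longrightarrow> m \<le> d x"
        "\<And>x. \<bar>x - a\<bar> \<le> \<delta> \<Longrightarrow> d x \<le> M"
        "\<And>x y. \<bar>x - a\<bar> \<le> \<delta> \<Longrightarrow> \<bar>y - a\<bar> \<le> \<delta> \<Longrightarrow> \<bar>d x - d y\<bar> \<le> L * \<bar>x - y\<bar>"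
        using expansion_derivative_bounds[OF F] by metis
      have "eventually (\<lambda>k. v k < a + \<delta>) sequentially"
        using order_tendstoD(2)[OF va(1), of "a + \<delta>"] d(1) by simp
      then show ?thesis
      proof (rule eventually_mono)
        fix k assume k: "v k < a + \<delta>"
        have r: "\<bar>x - a\<bar> \<le> \<delta>" if "u k \<le> x" "x \<le> v k" for x
          using that k a(3)[OF uv(1)[of k]] by auto
        have "\<exists>x. u k < x \<and> x < v k \<and> f (v k) - f (u k) = (v k - u k) * d x"
          using uv(3) by (intro MVT2 d r) auto
        then obtain x where x: "u k < x" "x < v k" "f (v k) - f (u k) = (v k - u k) * d x" by auto
        have "(v k - u k) * m \<le> (v k - u k) * d x"
          using x uv(3)[of k] by (intro mult_left_mono d r) auto
        then show "m * (v k - u k) \<le> f (v k) - f (u k)" using x(3) by (simp add: mult.commute)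
      qed
    qed
    have d32: "(\<lambda>t. f3 (a + t) - f2 (a + t)) has_fps_expansion F3 - F2"
      by (rule has_fps_expansion_diff[OF F3(1) F2(1)])
    have d10: "(\<lambda>t. f1 (a + t) - f0 (a + t)) has_fps_expansion F1 - F0"
      by (rule has_fps_expansion_diff[OF F1(1) F0(1)])
    have "eventually (\<lambda>t. f3 (a + t) - f2 (a + t) \<noteq> 0) (at 0)"
      using expansion_eventually_nonzero[OF d32] ne by simp
    then have "eventually (\<lambda>k. f3 (a + (v k - a)) - f2 (a + (v k - a)) \<noteq> 0) sequentially"
      by (rule eventually_compose_filterlim[OF _ v0])
    then have "eventually (\<lambda>k. f3 (v k) - f2 (v k) \<noteq> 0) sequentially"
      by simp
    then have ineq: "eventually (\<lambda>k. m * \<kappa> * \<bar>(f1 (v k) - f0 (v k)) / (v k - a) ^ n\<bar>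
        \<le> \<bar>(f3 (v k) - f2 (v k)) / (v k - a) ^ n\<bar>) sequentially"
      using growth[OF F2] growth[OF F3]
    proof eventually_elim
      case (elim k)
      have "m * (v k - u k) \<le> \<bar>f3 (v k) - f2 (v k)\<bar>"
      proof (cases "f2 (v k) < f3 (v k)")
        case True
        then have "f2 (v k) \<le> f3 (u k)"
          using gap_separates_images[OF f(2), of f2 "u k" "v k"] f uv by auto
        then show ?thesis using elim by auto
      next
        case False
        then have "f3 (v k) < f2 (v k)" using elim by auto
        then have "f3 (v k) \<le> f2 (u k)"
          using gap_separates_images[OF f(1), of f3 "u k" "v k"] f uv by auto
        then show ?thesis using elim by auto
      qed
      moreover have "m * (\<kappa> * \<bar>f1 (v k) - f0 (v k)\<bar>) \<le> m * (v k - u k)"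
        using le m by (intro mult_left_mono) auto
      ultimately have "m * \<kappa> * \<bar>f1 (v k) - f0 (v k)\<bar> \<le> \<bar>f3 (v k) - f2 (v k)\<bar>" by simp
      then have "m * \<kappa> * \<bar>f1 (v k) - f0 (v k)\<bar> / (v k - a) ^ n \<le> \<bar>f3 (v k) - f2 (v k)\<bar> / (v k - a) ^ n"
        using va(2)[of k] by (intro divide_right_mono) auto
      then show ?case using va(2)[of k] by (simp add: abs_divide)
    qed
    have lim: "(\<lambda>k. \<bar>(g (v k) - h (v k)) / (v k - a) ^ n\<bar>) \<longlonglongrightarrow> \<bar>fps_nth (G - H) n\<bar>"
      if "(\<lambda>t. g (a + t) - h (a + t)) has_fps_expansion G - H" "n \<le> subdegree (G - H)" for g h G H
      using tendsto_rabs[OF filterlim_compose[OF expansion_quotient_tendsto[OF that] v0]] by simp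
    have "m * \<kappa> * \<bar>fps_nth (F1 - F0) n\<bar> \<le> \<bar>fps_nth (F3 - F2) n\<bar>"
      by (rule tendsto_le[OF trivial_limit_sequentially lim[OF d32 sub]
        tendsto_mult_left[OF lim[OF d10]] ineq]) (simp add: n)
    then show "m * \<kappa> * fps_nth (F1 - F0) n \<le> \<bar>fps_nth F3 n - fps_nth F2 n\<bar>"
      using pos by simp
  qed
qed

lemma uncountable_close_pair:
  fixes \<phi> :: "'a \<Rightarrow> real"
  assumes P: "uncountable P" and \<epsilon>: "0 < \<epsilon>"
  obtains x y where "x \<in> P" "y \<in> P" "x \<noteq> y" "\<bar>\<phi> x - \<phi> y\<bar> < \<epsilon>"
proof -
  have "\<not> inj_on (\<lambda>x. \<lfloor>\<phi> x / \<epsilon>\<rfloor>) P"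
    using P countableI' by blast
  then obtain x y where xy: "x \<in> P" "y \<in> P" "x \<noteq> y" "\<lfloor>\<phi> x / \<epsilon>\<rfloor> = \<lfloor>\<phi> y / \<epsilon>\<rfloor>"
    by (auto simp: inj_on_def)
  have "\<bar>\<phi> x / \<epsilon> - \<phi> y / \<epsilon>\<bar> < 1"
    using xy(4) by linarith
  then have "\<bar>\<phi> x - \<phi> y\<bar> < \<epsilon>"
    using \<epsilon> by (simp add: diff_divide_distrib[symmetric] abs_divide)
  with xy that show thesis by blast
qed

text \<open>
  An uncountable set of expansions would contain an uncountable subset with a common lower bound
  on the first derivatives. In it, choose a pair with the least order of contact \<open>n\<close>, so that
  \<open>coefficient_gap\<close> applies to every other pair. This contradicts the fact that uncountably many
  \<open>n\<close>-th coefficients cannot be uniformly separated.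
\<close>

lemma countable_expansions:
  fixes X Y :: "real set"
  assumes X: "closed X" and a: "a \<in> X" "a islimpt X" "\<And>x. x \<in> X \<Longrightarrow> a \<le> x"
    and no_interval: "\<And>c. a < c \<Longrightarrow> \<not> {a..c} \<subseteq> X"
  shows "countable {F. 0 < fps_nth F 1 \<and>
    (\<exists>f. strict_mono_on X f \<and> f ` X = Y \<and> (\<lambda>t. f (a + t)) has_fps_expansion F)}"
    (is "countable ?P")
proof (rule ccontr)
  assume unc: "uncountable ?P"
  define P where "P = (\<lambda>N. {F \<in> ?P. 1 / real (Suc N) < fps_nth F 1})"
  have "?P \<subseteq> (\<Union>N. P N)"
  proof
    fix F assume F: "F \<in> ?P"
    then obtain N where "1 / real (Suc N) < fps_nth F 1"
      using nat_approx_posE by blast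
    with F show "F \<in> (\<Union>N. P N)" unfolding P_def by blast
  qed
  then obtain N where N: "uncountable (P N)"
    using unc countable_subset[of ?P "\<Union>N. P N"] by auto
  define m where "m = 1 / real (Suc N)"
  have m: "0 < m" by (simp add: m_def)
  define D where "D = (\<lambda>n. \<exists>F G. F \<in> P N \<and> G \<in> P N \<and> F \<noteq> G \<and> subdegree (F - G) = n)"
  obtain F G where "F \<in> P N" "G \<in> P N" "F \<noteq> G"
    using uncountable_close_pair[OF N zero_less_one, of "\<lambda>_. 0"] .
  then have "D (subdegree (F - G))" unfolding D_def by blast
  then obtain n where n: "D n" "\<And>k. D k \<Longrightarrow> n \<le> k"
    by (metis LeastI Least_le)
  obtain F G where FG: "F \<in> P N" "G \<in> P N" "F \<noteq> G" "subdegree (F - G) = n"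
    using n(1) unfolding D_def by blast
  have "\<exists>F0 F1. F0 \<in> P N \<and> F1 \<in> P N \<and> subdegree (F1 - F0) = n \<and> 0 < fps_nth (F1 - F0) n"
  proof (cases "0 < fps_nth (F - G) n")
    case True
    then show ?thesis using FG by blast
  next
    case False
    have "fps_nth (F - G) n \<noteq> 0" using FG by (metis nth_subdegree_nonzero right_minus_eq)
    then have "0 < fps_nth (G - F) n" using False by simp
    moreover have "subdegree (G - F) = n" using FG subdegree_minus_commute by metis
    ultimately show ?thesis using FG by blast
  qed
  then obtain F0 F1 where F: "F0 \<in> P N" "F1 \<in> P N" "n = subdegree (F1 - F0)" "0 < fps_nth (F1 - F0) n"
    by blast
  obtain f0 f1 where f: "strict_mono_on X f0" "f0 ` X = Y" "(\<lambda>t. f0 (a + t)) has_fps_expansion F0"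
    "0 < fps_nth F0 1" "strict_mono_on X f1" "f1 ` X = Y" "(\<lambda>t. f1 (a + t)) has_fps_expansion F1"
    "0 < fps_nth F1 1"
    using F(1,2) by (auto simp: P_def)
  obtain \<epsilon> where \<epsilon>: "0 < \<epsilon>"
    "\<And>f2 f3 F2 F3. \<lbrakk>strict_mono_on X f2; strict_mono_on X f3; f2 ` X = Y; f3 ` X = Y;
      (\<lambda>t. f2 (a + t)) has_fps_expansion F2; m < fps_nth F2 1;
      (\<lambda>t. f3 (a + t)) has_fps_expansion F3; m < fps_nth F3 1;
      F2 \<noteq> F3; n \<le> subdegree (F3 - F2)\<rbrakk> \<Longrightarrow> \<epsilon> \<le> \<bar>fps_nth F3 n - fps_nth F2 n\<bar>"
    using coefficient_gap[OF X a no_interval f(1,5,2,6,3,4,7,8) F(4,3) m] by metis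
  obtain F2 F3 where F23: "F3 \<in> P N" "F2 \<in> P N" "F3 \<noteq> F2" "\<bar>fps_nth F3 n - fps_nth F2 n\<bar> < \<epsilon>"
    using uncountable_close_pair[OF N \<epsilon>(1), of "\<lambda>F. fps_nth F n"] .
  have "n \<le> subdegree (F3 - F2)"
    using F23 n(2) unfolding D_def by blast
  moreover obtain f2 where "strict_mono_on X f2" "f2 ` X = Y" "(\<lambda>t. f2 (a + t)) has_fps_expansion F2"
    "m < fps_nth F2 1"
    using F23(2) by (auto simp: P_def m_def)
  moreover obtain f3 where "strict_mono_on X f3" "f3 ` X = Y" "(\<lambda>t. f3 (a + t)) has_fps_expansion F3"
    "m < fps_nth F3 1"
    using F23(1) by (auto simp: P_def m_def)
  ultimately have "\<epsilon> \<le> \<bar>fps_nth F3 n - fps_nth F2 n\<bar>"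
    using F23(3) by (intro \<epsilon>(2)) auto
  with F23(4) show False by simp
qed

section \<open>Cantor sets and critical points\<close>

text \<open>
  Otherwise the sets \<open>S - T\<close> would be countably many dense relatively open subsets of \<open>S\<close> with empty
  intersection.
\<close>

lemma Baire_closed_cover:
  fixes S :: "'a::{real_normed_vector,heine_borel} set"
  assumes S: "closed S" "S \<noteq> {}" and \<T>: "countable \<T>" "\<And>T. T \<in> \<T> \<Longrightarrow> closed T" "S \<subseteq> \<Union>\<T>"
  obtains T y e where "T \<in> \<T>" "y \<in> S" "0 < e" "S \<inter> ball y e \<subseteq> T"
proof -
  have "\<exists>T\<in>\<T>. \<not> S \<subseteq> closure (S - T)"
  proof (rule ccontr)
    assume "\<not> ?thesis"
    then have dense: "\<And>T. T \<in> \<T> \<Longrightarrow> S \<subseteq> closure (S - T)" by blast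
    have "S \<subseteq> closure (\<Inter>((\<lambda>T. S - T) ` \<T>))"
    proof (rule Baire[OF S(1)])
      show "openin (top_of_set S) G \<and> S \<subseteq> closure G" if G: "G \<in> (\<lambda>T. S - T) ` \<T>" for G
      proof -
        obtain T where T: "T \<in> \<T>" "G = S - T" using G by blast
        have "G = S \<inter> - T" using T by blast
        moreover have "open (- T)" using \<T>(2)[OF T(1)] by (simp add: open_Compl)
        ultimately have "openin (top_of_set S) G" by (simp add: openin_open_Int)
        then show ?thesis using dense T by blast
      qed
    qed (use \<T>(1) in simp)
    moreover have "\<Inter>((\<lambda>T. S - T) ` \<T>) = {}"
    proof (rule equals0I)
      fix y assume y: "y \<in> \<Inter>((\<lambda>T. S - T) ` \<T>)"
      obtain T where "T \<in> \<T>" using S(2) \<T>(3) by blast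
      then have "y \<in> S" using y by blast
      then obtain T' where "T' \<in> \<T>" "y \<in> T'" using \<T>(3) by blast
      then show False using y by blast
    qed
    ultimately show False using S(2) by simp
  qed
  then obtain T y where T: "T \<in> \<T>" "y \<in> S" "y \<notin> closure (S - T)" by blast
  then obtain e where "0 < e" "\<And>z. z \<in> S - T \<Longrightarrow> \<not> dist z y < e"
    unfolding closure_approachable by blast
  then have "S \<inter> ball y e \<subseteq> T" by (fastforce simp: dist_commute)
  with T \<open>0 < e\<close> that show thesis by blast
qed

lemma cantor_set_no_interval:
  fixes X :: "real set"
  assumes "cantor_set X" and "a < b"
  shows "\<not> {a..b} \<subseteq> X"
proof
  assume sub: "{a..b} \<subseteq> X"
  have "{a..b} \<subseteq> connected_component_set X a"
    using sub assms(2) by (intro connected_component_maximal) auto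
  moreover have "a \<in> X" using sub assms(2) by auto
  then have "connected_component_set X a = {a}"
    using assms(1) unfolding cantor_set_def totally_disconnected_def by blast
  moreover have "b \<in> {a..b}" using assms(2) by simp
  ultimately have "b \<in> {a}" by blast
  then show False using assms(2) by simp
qed

lemma rational_off_cantor_set:
  fixes X :: "real set"
  assumes X: "cantor_set X" and "a < b"
  obtains q where "q \<in> \<rat>" "a < q" "q < b" "q \<notin> X"
proof -
  obtain a' b' where ab: "a < a'" "a' < b'" "b' < b" using dense assms(2) by meson
  obtain z where z: "a' \<le> z" "z \<le> b'" "z \<notin> X"
    using cantor_set_no_interval[OF X ab(2)] by (auto simp: subset_eq)
  have "open ({a<..<b} \<inter> - X)"
    using X by (intro open_Int open_Compl compact_imp_closed) (auto simp: cantor_set_def)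
  moreover have "z \<in> {a<..<b} \<inter> - X" using ab z by auto
  ultimately obtain e where e: "0 < e" "ball z e \<subseteq> {a<..<b} \<inter> - X"
    using openE by meson
  obtain q where q: "q \<in> \<rat>" "z < q" "q < z + e"
    using Rats_dense_in_real[of z "z + e"] e(1) by auto
  then have "q \<in> ball z e" by (simp add: dist_real_def)
  then have "q \<in> {a<..<b} \<inter> - X" using e(2) by blast
  then show thesis using q that by auto
qed

lemma cantor_set_islimpt: "cantor_set X \<Longrightarrow> x \<in> X \<Longrightarrow> x islimpt X"
  unfolding cantor_set_def using isolated_in_islimpt_iff by blast

lemma real_analytic_on_derivative:
  assumes "g real_analytic_on I" and "x \<in> I"
  obtains F where "(\<lambda>t. g (x + t)) has_fps_expansion F" "(g has_real_derivative fps_nth F 1) (at x)"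
proof -
  obtain F where F: "(\<lambda>t. g (x + t)) has_fps_expansion F"
    using assms unfolding real_analytic_on_def by blast
  obtain \<delta> g' where "(0::real) < \<delta>" "g' x = fps_nth F 1"
    "\<And>z. \<bar>z - x\<bar> \<le> \<delta> \<Longrightarrow> (g has_real_derivative g' z) (at z)"
    using expansion_lipschitz_derivative[OF F] by metis
  then have "(g has_real_derivative fps_nth F 1) (at x)" by (metis abs_zero diff_self less_imp_le)
  with F that show thesis by blast
qed

text \<open>
  If the critical points accumulate at \<open>z\<close>, then the expansion of \<open>deriv g\<close> at \<open>z\<close> vanishes, and the
  identity theorem makes \<open>g\<close> constant.
\<close>

lemma finite_critical_points:
  assumes I: "open I" "connected I" and g: "g real_analytic_on I"
    and X: "compact X" "X \<subseteq> I" and nonconst: "\<And>c. \<exists>x\<in>I. g x \<noteq> c"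
  shows "finite {x \<in> X. deriv g x = 0}"
proof (rule ccontr)
  assume "infinite {x \<in> X. deriv g x = 0}"
  then obtain z where z: "z \<in> X" "z islimpt {x \<in> X. deriv g x = 0}"
    using X(1) compact_eq_Bolzano_Weierstrass by (metis (no_types, lifting) mem_Collect_eq subsetI)
  obtain F where F: "(\<lambda>t. g (z + t)) has_fps_expansion F"
    using g z X(2) unfolding real_analytic_on_def by blast
  have shift: "deriv (\<lambda>t. g (z + t)) = (\<lambda>t. deriv g (z + t))"
    unfolding deriv_def by (simp add: DERIV_shift add.commute)
  have d: "(\<lambda>t. deriv g (z + t)) has_fps_expansion fps_deriv F"
    using has_fps_expansion_deriv[OF F] by (simp add: shift)
  have "fps_deriv F = 0"
  proof (rule ccontr)
    assume "fps_deriv F \<noteq> 0"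
    from expansion_eventually_nonzero[OF d this]
    have "eventually (\<lambda>x. deriv g x \<noteq> 0) (at z)"
      by (subst at_to_0) (simp add: eventually_filtermap add.commute)
    then show False
      using z(2) unfolding islimpt_def eventually_at_topological by blast
  qed
  then have "F = fps_const (fps_nth F 0)" by (simp add: fps_deriv_eq_0_iff)
  then obtain c where "F = fps_const c" by blast
  then have "eventually (\<lambda>t. g (z + t) = c) (nhds 0)"
    using F by (auto simp: has_fps_expansion_def elim: eventually_mono)
  then have ev: "eventually (\<lambda>x. g x = c) (nhds z)"
    by - (rule eventually_nhds_shift, simp)
  have "(\<lambda>_. c) real_analytic_on I" unfolding real_analytic_on_def by blast
  then have "g x = c" if "x \<in> I" for x
    using analytic_identity[OF I(2,1) g _ _ ev that] z X(2) by blast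
  then show False using nonconst by blast
qed

lemma sign_definite_piece:
  assumes X: "cantor_set X" and g: "(\<lambda>t. g (x + t)) has_fps_expansion F" and nz: "fps_nth F 1 \<noteq> 0"
  obtains \<sigma> p q where "\<sigma> \<in> {-1, 1}" "p \<in> \<rat> - X" "q \<in> \<rat> - X" "p < x" "x < q"
    "\<And>z. z \<in> {p..q} \<Longrightarrow> \<exists>D>0. ((\<lambda>y. \<sigma> * g y) has_real_derivative D) (at z)"
proof -
  define \<sigma> where "\<sigma> = sgn (fps_nth F 1)"
  have \<sigma>: "\<sigma> \<in> {-1, 1}" using nz by (auto simp: \<sigma>_def sgn_if)
  have "(\<lambda>t. \<sigma> * g (x + t)) has_fps_expansion fps_const \<sigma> * F"
    using g by (rule has_fps_expansion_cmult_left)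
  moreover define m where "m = fps_nth (fps_const \<sigma> * F) 1 / 2"
  have m: "0 < m" "m < fps_nth (fps_const \<sigma> * F) 1" using nz by (simp_all add: m_def \<sigma>_def sgn_if)
  ultimately obtain \<delta> L M d where \<delta>: "0 < \<delta>" "0 \<le> (L::real)"
    "\<And>z. \<bar>z - x\<bar> \<le> \<delta> \<Longrightarrow> ((\<lambda>y. \<sigma> * g y) has_real_derivative d z) (at z)"
    "\<And>z. \<bar>z - x\<bar> \<le> \<delta> \<Longrightarrow> m \<le> d z"
    "\<And>z. \<bar>z - x\<bar> \<le> \<delta> \<Longrightarrow> d z \<le> M"
    using expansion_derivative_bounds[of "\<lambda>y. \<sigma> * g y" x "fps_const \<sigma> * F" m] by metis
  obtain p where p: "p \<in> \<rat>" "x - \<delta> < p" "p < x" "p \<notin> X"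
    using rational_off_cantor_set[OF X, of "x - \<delta>" x] \<delta>(1) by auto
  obtain q where q: "q \<in> \<rat>" "x < q" "q < x + \<delta>" "q \<notin> X"
    using rational_off_cantor_set[OF X, of x "x + \<delta>"] \<delta>(1) by auto
  show thesis
  proof (rule that[OF \<sigma>])
    fix z assume "z \<in> {p..q}"
    then have "\<bar>z - x\<bar> \<le> \<delta>" using p q by auto
    then show "\<exists>D>0. ((\<lambda>y. \<sigma> * g y) has_real_derivative D) (at z)"
      using \<delta>(3,4)[of z] m(1) by (intro exI[of _ "d z"]) auto
  qed (use p q in auto)
qed

section \<open>Reduction to monotone bijections\<close>

text \<open>
  Baire's theorem is applied to the cover of \<open>Y\<close> by the critical values and by the images of the
  countably many pieces \<open>X \<inter> {p..q}\<close> on which the derivative of \<open>g\<close> has a constant sign. A singleton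
  cannot contain an open part of the perfect set \<open>Y\<close>, so one of the pieces does. Since \<open>Y \<inter> {r..s}\<close> is
  relatively open for \<open>r\<close> and \<open>s\<close> outside of \<open>Y\<close>, its preimage in the piece is relatively open in \<open>X\<close>
  and convex relative to \<open>X\<close>; its end points can therefore be moved to rational points outside
  of \<open>X\<close>.
\<close>

lemma monotone_piece:
  assumes X: "cantor_set X" and Y: "cantor_set Y" and I: "open I" "connected I" "X \<subseteq> I"
    and g: "g real_analytic_on I" and img: "g ` X = Y"
  obtains \<sigma> p q r s F where "\<sigma> \<in> {-1, 1}" "p \<in> \<rat> - X" "q \<in> \<rat> - X" "r \<in> \<rat>" "s \<in> \<rat>"
    "X \<inter> {p..q} \<noteq> {}" "strict_mono_on (X \<inter> {p..q}) (\<lambda>x. \<sigma> * g x)" "g ` (X \<inter> {p..q}) = Y \<inter> {r..s}"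
    "(\<lambda>t. \<sigma> * g (Inf (X \<inter> {p..q}) + t)) has_fps_expansion F" "0 < fps_nth F 1"
proof -
  have cX: "compact X" and cY: "closed Y" "Y \<noteq> {}"
    using X Y by (auto simp: cantor_set_def compact_imp_closed)
  have nonisolated: "\<not> Y \<inter> ball y e \<subseteq> {c}" if ye: "y \<in> Y" "0 < e" for y e c
  proof
    assume sub: "Y \<inter> ball y e \<subseteq> {c}"
    obtain z where "z \<in> Y" "z \<noteq> y" "dist z y < e"
      using cantor_set_islimpt[OF Y ye(1)] ye(2) by (auto simp: islimpt_approachable)
    then have "z \<in> {c}" "y \<in> {c}" using sub ye by (auto simp: dist_commute)
    then show False using \<open>z \<noteq> y\<close> by simp
  qed
  define crit where "crit = {x \<in> X. deriv g x = 0}"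
  have fin: "finite crit"
    unfolding crit_def
  proof (rule finite_critical_points[OF I(1,2) g cX I(3)])
    show "\<exists>x\<in>I. g x \<noteq> c" for c
    proof (rule ccontr)
      assume "\<not> ?thesis"
      then have "Y \<subseteq> {c}" using img I(3) by auto
      moreover obtain y where "y \<in> Y" using cY by blast
      ultimately show False using nonisolated[of y 1 c] by auto
    qed
  qed
  define C where "C = {(\<sigma>, p, q). \<sigma> \<in> {-1, 1::real} \<and> p \<in> \<rat> - X \<and> q \<in> \<rat> - X \<and>
    (\<forall>z\<in>{p..q}. \<exists>D>0. ((\<lambda>y. \<sigma> * g y) has_real_derivative D) (at z))}"
  define \<T> where "\<T> = (\<lambda>c. {g c}) ` crit \<union> (\<lambda>(\<sigma>, p, q). g ` (X \<inter> {p..q})) ` C"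
  have cont_g: "isCont g z" if "(\<sigma>, p, q) \<in> C" "z \<in> {p..q}" for \<sigma> p q z
  proof -
    have \<sigma>: "\<sigma> \<in> {-1, 1}" using that by (auto simp: C_def)
    have "isCont (\<lambda>y. \<sigma> * g y) z"
      using that unfolding C_def by (auto intro: DERIV_isCont)
    then have "isCont (\<lambda>y. \<sigma> * (\<sigma> * g y)) z" by (rule continuous_mult_left)
    then show ?thesis using \<sigma> by auto
  qed
  have "countable C"
  proof (rule countable_subset)
    show "C \<subseteq> {-1, 1} \<times> \<rat> \<times> \<rat>" by (auto simp: C_def)
  qed (simp add: countable_rat)
  then have "countable \<T>" using fin by (auto simp: \<T>_def intro: countable_finite)
  moreover have "closed T" if T: "T \<in> \<T>" for T
  proof -
    have "closed (g ` (X \<inter> {p..q}))" if "(\<sigma>, p, q) \<in> C" for \<sigma> p q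
    proof (rule compact_imp_closed, rule compact_continuous_image)
      show "continuous_on (X \<inter> {p..q}) g"
        using cont_g[OF that] by (auto intro: continuous_at_imp_continuous_on)
      show "compact (X \<inter> {p..q})" using cX by (intro compact_Int) auto
    qed
    then show ?thesis using T by (auto simp: \<T>_def)
  qed
  moreover have "Y \<subseteq> \<Union>\<T>"
  proof
    fix y assume "y \<in> Y"
    then obtain x where x: "x \<in> X" "y = g x" using img by auto
    show "y \<in> \<Union>\<T>"
    proof (cases "x \<in> crit")
      case True
      then show ?thesis using x by (auto simp: \<T>_def)
    next
      case False
      obtain F where F: "(\<lambda>t. g (x + t)) has_fps_expansion F" "(g has_real_derivative fps_nth F 1) (at x)"
        using real_analytic_on_derivative[OF g] x I(3) by blast
      have "fps_nth F 1 \<noteq> 0" using False x DERIV_imp_deriv[OF F(2)] by (auto simp: crit_def)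
      then obtain \<sigma> p q where "\<sigma> \<in> {-1, 1}" "p \<in> \<rat> - X" "q \<in> \<rat> - X" "p < x" "x < q"
        "\<And>z. z \<in> {p..q} \<Longrightarrow> \<exists>D>0. ((\<lambda>y. \<sigma> * g y) has_real_derivative D) (at z)"
        using sign_definite_piece[OF X F(1)] by metis
      then have "(\<sigma>, p, q) \<in> C" "y \<in> g ` (X \<inter> {p..q})" using x by (auto simp: C_def)
      then show ?thesis unfolding \<T>_def by blast
    qed
  qed
  ultimately obtain T y e where T: "T \<in> \<T>" "y \<in> Y" "0 < e" "Y \<inter> ball y e \<subseteq> T"
    using Baire_closed_cover[OF cY] by metis
  then obtain \<sigma> p q where C: "(\<sigma>, p, q) \<in> C" "T = g ` (X \<inter> {p..q})"
    using nonisolated[OF T(2,3)] by (auto simp: \<T>_def)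
  have \<sigma>: "\<sigma> \<in> {-1, 1}" and pq: "p \<in> \<rat> - X" "q \<in> \<rat> - X"
    and D: "\<And>z. z \<in> {p..q} \<Longrightarrow> \<exists>D>0. ((\<lambda>y. \<sigma> * g y) has_real_derivative D) (at z)"
    using C(1) by (auto simp: C_def)
  have mono: "\<sigma> * g x < \<sigma> * g z" if "p \<le> x" "x < z" "z \<le> q" for x z
  proof (rule DERIV_pos_imp_increasing[OF that(2), of "\<lambda>y. \<sigma> * g y"])
    fix w assume "x \<le> w" "w \<le> z"
    then show "\<exists>D. ((\<lambda>y. \<sigma> * g y) has_real_derivative D) (at w) \<and> 0 < D"
      using D[of w] that by auto
  qed
  obtain r where r: "r \<in> \<rat>" "y - e < r" "r < y" "r \<notin> Y"
    using rational_off_cantor_set[OF Y, of "y - e" y] T(3) by auto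
  obtain s where s: "s \<in> \<rat>" "y < s" "s < y + e" "s \<notin> Y"
    using rational_off_cantor_set[OF Y, of y "y + e"] T(3) by auto
  have YT: "Y \<inter> {r..s} \<subseteq> T"
  proof
    fix w assume w: "w \<in> Y \<inter> {r..s}"
    then have "w \<in> ball y e" using r s by (auto simp: dist_real_def)
    then show "w \<in> T" using T(4) w by blast
  qed
  \<comment> \<open>The preimage of \<open>Y \<inter> {r..s}\<close>; it depends on \<open>g\<close> and has to be rewritten as an intersection of \<open>X\<close>
      with an interval that has rational end points.\<close>
  define X' where "X' = X \<inter> {p..q} \<inter> {x. r \<le> g x \<and> g x \<le> s}"
  have img': "g ` X' = Y \<inter> {r..s}"
    using YT C(2) img by (auto simp: X'_def)
  have "compact X'"
  proof -
    have "continuous_on (X \<inter> {p..q}) g"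
      using cont_g[OF C(1)] by (auto intro: continuous_at_imp_continuous_on)
    then have "closedin (top_of_set (X \<inter> {p..q})) (X \<inter> {p..q} \<inter> g -` {r..s})"
      by (rule continuous_closedin_preimage) auto
    moreover have "X \<inter> {p..q} \<inter> g -` {r..s} = X'" by (auto simp: X'_def)
    moreover have "compact (X \<inter> {p..q})" using cX by (intro compact_Int) auto
    ultimately show ?thesis using closedin_compact by metis
  qed
  moreover have "X' \<noteq> {}" using img' T(2) r s by auto
  ultimately obtain \<alpha> \<beta> where \<alpha>: "\<alpha> \<in> X'" "\<And>x. x \<in> X' \<Longrightarrow> \<alpha> \<le> x" and \<beta>: "\<beta> \<in> X'" "\<And>x. x \<in> X' \<Longrightarrow> x \<le> \<beta>"
    using compact_attains_inf[of X'] compact_attains_sup[of X'] by blast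
  have near: "\<exists>d>0. \<forall>x\<in>X. \<bar>x - z\<bar> < d \<longrightarrow> x \<in> X'" if z: "z \<in> X'" for z
  proof -
    have zX: "z \<in> X" "z \<in> {p..q}" "r \<le> g z" "g z \<le> s" using z by (auto simp: X'_def)
    have "g z \<in> Y" using zX img by auto
    then have "g z \<in> {r<..<s}" using zX r s by (auto simp: less_le)
    then have "eventually (\<lambda>x. g x \<in> {r<..<s}) (nhds z)"
      using cont_g[OF C(1) zX(2)] by (intro topological_tendstoD[of g "g z"])
        (auto simp: continuous_at tendsto_nhds_iff)
    moreover have "z \<in> {p<..<q}" using zX pq by (auto simp: less_le)
    then have "eventually (\<lambda>x. x \<in> {p<..<q}) (nhds z)"
      by (intro eventually_nhds_in_open) auto
    ultimately have "eventually (\<lambda>x. x \<in> X \<longrightarrow> x \<in> X') (nhds z)"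
      by eventually_elim (auto simp: X'_def)
    then show ?thesis
      by (auto simp: eventually_nhds_metric dist_real_def)
  qed
  obtain d where d: "0 < d" "\<And>x. x \<in> X \<Longrightarrow> \<bar>x - \<alpha>\<bar> < d \<Longrightarrow> x \<in> X'"
    using near[OF \<alpha>(1)] by blast
  obtain p' where p': "p' \<in> \<rat>" "\<alpha> - d < p'" "p' < \<alpha>" "p' \<notin> X"
    using rational_off_cantor_set[OF X, of "\<alpha> - d" \<alpha>] d(1) by auto
  obtain d' where d': "0 < d'" "\<And>x. x \<in> X \<Longrightarrow> \<bar>x - \<beta>\<bar> < d' \<Longrightarrow> x \<in> X'"
    using near[OF \<beta>(1)] by blast
  obtain q' where q': "q' \<in> \<rat>" "\<beta> < q'" "q' < \<beta> + d'" "q' \<notin> X"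
    using rational_off_cantor_set[OF X, of \<beta> "\<beta> + d'"] d'(1) by auto
  have eq: "X \<inter> {p'..q'} = X'"
  proof
    show "X' \<subseteq> X \<inter> {p'..q'}" using \<alpha>(2) \<beta>(2) p' q' by (force simp: X'_def)
    show "X \<inter> {p'..q'} \<subseteq> X'"
    proof
      fix x assume x: "x \<in> X \<inter> {p'..q'}"
      have ab: "\<alpha> \<le> x"
      proof (rule ccontr)
        assume "\<not> \<alpha> \<le> x"
        then have "x \<in> X'" using x p' by (intro d(2)) auto
        then show False using \<alpha>(2) \<open>\<not> \<alpha> \<le> x\<close> by blast
      qed
      have bb: "x \<le> \<beta>"
      proof (rule ccontr)
        assume "\<not> x \<le> \<beta>"
        then have "x \<in> X'" using x q' by (intro d'(2)) auto
        then show False using \<beta>(2) \<open>\<not> x \<le> \<beta>\<close> by blast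
      qed
      have bounds: "p \<le> \<alpha>" "\<beta> \<le> q" "r \<le> g \<alpha>" "g \<alpha> \<le> s" "r \<le> g \<beta>" "g \<beta> \<le> s"
        using \<alpha>(1) \<beta>(1) by (auto simp: X'_def)
      have "\<sigma> * g \<alpha> \<le> \<sigma> * g x"
        using mono[of \<alpha> x] ab bb bounds(1,2) by (cases "\<alpha> = x") simp_all
      moreover have "\<sigma> * g x \<le> \<sigma> * g \<beta>"
        using mono[of x \<beta>] ab bb bounds(1,2) by (cases "x = \<beta>") simp_all
      ultimately have "r \<le> g x" "g x \<le> s"
        using \<sigma> bounds(3-6) by auto
      then show "x \<in> X'"
        using x ab bb bounds(1,2) by (simp add: X'_def)
    qed
  qed
  have Inf: "Inf (X \<inter> {p'..q'}) = \<alpha>"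
    unfolding eq using \<alpha> by (rule cInf_eq_minimum)
  have \<alpha>pq: "\<alpha> \<in> {p..q}" "\<alpha> \<in> X" using \<alpha>(1) by (auto simp: X'_def)
  obtain G where G: "(\<lambda>t. g (\<alpha> + t)) has_fps_expansion G" "(g has_real_derivative fps_nth G 1) (at \<alpha>)"
    using real_analytic_on_derivative[OF g] \<alpha>pq I(3) by blast
  have "((\<lambda>y. \<sigma> * g y) has_real_derivative \<sigma> * fps_nth G 1) (at \<alpha>)"
    using G(2) by (rule DERIV_cmult)
  then have pos: "0 < fps_nth (fps_const \<sigma> * G) 1"
    using D[OF \<alpha>pq(1)] DERIV_unique by fastforce
  show thesis
  proof (rule that[of \<sigma> p' q' r s "fps_const \<sigma> * G"])
    show "strict_mono_on (X \<inter> {p'..q'}) (\<lambda>x. \<sigma> * g x)"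
      unfolding eq by (rule strict_mono_onI) (auto simp: X'_def intro: mono)
    show "(\<lambda>t. \<sigma> * g (Inf (X \<inter> {p'..q'}) + t)) has_fps_expansion fps_const \<sigma> * G"
      unfolding Inf using G(1) by (rule has_fps_expansion_cmult_left)
  qed (use \<sigma> p' q' r s eq img' \<alpha>(1) pos in auto)
qed

theorem theorem1p1:
  fixes X Y :: "real set"
  assumes "cantor_set X" and "cantor_set Y"
  shows "countable (End_omega X Y)"
proof -
  \<comment> \<open>\<open>R j f F\<close> says that some analytic extension of \<open>f\<close> is, up to sign, an increasing bijection between
      the pieces of \<open>X\<close> and \<open>Y\<close> described by \<open>j\<close>, with expansion \<open>F\<close> at the minimum of its piece.\<close>
  define R where "R = (\<lambda>(\<sigma>, p, q, r, s) f F. \<exists>I g.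
    open I \<and> connected I \<and> X \<subseteq> I \<and> g real_analytic_on I \<and> (\<forall>x\<in>X. g x = f x) \<and>
    \<sigma> \<in> {-1, 1::real} \<and> p \<notin> X \<and> q \<notin> X \<and> X \<inter> {p..q} \<noteq> {} \<and>
    strict_mono_on (X \<inter> {p..q}) (\<lambda>x. \<sigma> * g x) \<and> g ` (X \<inter> {p..q}) = Y \<inter> {r..s} \<and>
    (\<lambda>t. \<sigma> * g (Inf (X \<inter> {p..q}) + t)) has_fps_expansion F \<and> 0 < fps_nth F 1)"
  define J :: "(real \<times> real \<times> real \<times> real \<times> real) set"
    where "J = {-1, 1} \<times> \<rat> \<times> \<rat> \<times> \<rat> \<times> \<rat>"
  define E where "E = (\<lambda>j. {f \<in> End_omega X Y. \<exists>F. R j f F})"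
  have "countable J" by (simp add: J_def countable_rat)
  moreover have "countable (E j)" for j
  proof -
    obtain \<sigma> p q r s where j: "j = (\<sigma>, p, q, r, s)" by (cases j)
    \<comment> \<open>The map \<open>\<Phi>\<close> embeds \<open>E j\<close> into a countable set of power series.\<close>
    define \<Phi> where "\<Phi> = (\<lambda>f. SOME F. R j f F)"
    have \<Phi>: "R j f (\<Phi> f)" if "f \<in> E j" for f
      using that unfolding E_def \<Phi>_def by (auto intro: someI_ex)
    define X' where "X' = X \<inter> {p..q}"
    define Y' where "Y' = (\<lambda>y. \<sigma> * y) ` (Y \<inter> {r..s})"
    show ?thesis
    proof (cases "E j = {}")
      case False
      then obtain f0 where "R j f0 (\<Phi> f0)" using \<Phi> by blast
      then have pq: "p \<notin> X" "q \<notin> X" "X' \<noteq> {}" and \<sigma>: "\<sigma> \<noteq> 0" by (auto simp: R_def j X'_def)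
      have cX': "compact X'" using assms(1) unfolding X'_def cantor_set_def by (simp add: compact_Int_closed)
      obtain a where a: "a \<in> X'" "\<And>x. x \<in> X' \<Longrightarrow> a \<le> x"
        using compact_attains_inf[OF cX' pq(3)] by metis
      have Inf: "Inf X' = a" using a by (rule cInf_eq_minimum)
      have aX: "a \<in> X" using a by (simp add: X'_def)
      have "p < a" "a < q" using a(1) aX pq by (auto simp: X'_def less_le)
      then have "eventually (\<lambda>x. x \<in> {p<..<q}) (at a)"
        by (intro eventually_at_in_open') auto
      then have "eventually (\<lambda>x. x \<in> {p..q}) (at a)" by (rule eventually_mono) auto
      then have lim: "a islimpt X'"
        unfolding X'_def using cantor_set_islimpt[OF assms(1) aX] islimpt_Int_eventually by blast
      have "countable {F. 0 < fps_nth F 1 \<and>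
          (\<exists>f. strict_mono_on X' f \<and> f ` X' = Y' \<and> (\<lambda>t. f (a + t)) has_fps_expansion F)}"
      proof (rule countable_expansions[OF _ a(1) lim a(2)])
        show "closed X'" using cX' by (rule compact_imp_closed)
        show "\<not> {a..c} \<subseteq> X'" if "a < c" for c
          using cantor_set_no_interval[OF assms(1) that] by (auto simp: X'_def)
      qed
      moreover have "\<Phi> ` E j \<subseteq> {F. 0 < fps_nth F 1 \<and>
          (\<exists>f. strict_mono_on X' f \<and> f ` X' = Y' \<and> (\<lambda>t. f (a + t)) has_fps_expansion F)}"
      proof (rule image_subsetI)
        fix f assume "f \<in> E j"
        from \<Phi>[OF this] obtain g where g: "strict_mono_on X' (\<lambda>x. \<sigma> * g x)"
          "g ` X' = Y \<inter> {r..s}" "(\<lambda>t. \<sigma> * g (a + t)) has_fps_expansion \<Phi> f" "0 < fps_nth (\<Phi> f) 1"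
          unfolding R_def j prod.case X'_def[symmetric] Inf by blast
        have "(\<lambda>x. \<sigma> * g x) ` X' = Y'" unfolding Y'_def g(2)[symmetric] by (simp add: image_image)
        then show "\<Phi> f \<in> {F. 0 < fps_nth F 1 \<and>
          (\<exists>f. strict_mono_on X' f \<and> f ` X' = Y' \<and> (\<lambda>t. f (a + t)) has_fps_expansion F)}"
          using g by (intro CollectI conjI exI[of _ "\<lambda>x. \<sigma> * g x"]) auto
      qed
      ultimately have "countable (\<Phi> ` E j)" by (rule countable_subset[rotated])
      moreover have "inj_on \<Phi> (E j)"
      proof (rule inj_onI)
        fix f h assume fh: "f \<in> E j" "h \<in> E j" "\<Phi> f = \<Phi> h"
        obtain I g where g: "open I" "connected I" "X \<subseteq> I" "g real_analytic_on I" "\<And>x. x \<in> X \<Longrightarrow> g x = f x"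
          "(\<lambda>t. \<sigma> * g (a + t)) has_fps_expansion \<Phi> f"
          using \<Phi>[OF fh(1)] unfolding R_def j prod.case X'_def[symmetric] Inf by blast
        obtain I' g' where g': "open I'" "connected I'" "X \<subseteq> I'" "g' real_analytic_on I'" "\<And>x. x \<in> X \<Longrightarrow> g' x = h x"
          "(\<lambda>t. \<sigma> * g' (a + t)) has_fps_expansion \<Phi> h"
          using \<Phi>[OF fh(2)] unfolding R_def j prod.case X'_def[symmetric] Inf by blast
        have "eventually (\<lambda>t. eval_fps (\<Phi> f) t = \<sigma> * g (a + t)) (nhds 0)"
          "eventually (\<lambda>t. eval_fps (\<Phi> f) t = \<sigma> * g' (a + t)) (nhds 0)"
          using g(6) g'(6) fh(3) by (auto simp: has_fps_expansion_def)
        then have "eventually (\<lambda>t. g (a + t) = g' (a + t)) (nhds 0)"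
          by eventually_elim (use \<sigma> in auto)
        then have ev: "eventually (\<lambda>x. g x = g' x) (nhds a)"
          by - (rule eventually_nhds_shift, simp)
        have "connected (I \<inter> I')"
          using g(2) g'(2) is_interval_connected_1 is_interval_Int by blast
        moreover have "open (I \<inter> I')" using g(1) g'(1) by (rule open_Int)
        moreover have "g real_analytic_on (I \<inter> I')" "g' real_analytic_on (I \<inter> I')"
          using g(4) g'(4) by (auto simp: real_analytic_on_def)
        moreover have "a \<in> I \<inter> I'" using aX g(3) g'(3) by blast
        ultimately have "g x = g' x" if "x \<in> X" for x
          using analytic_identity[OF _ _ _ _ _ ev, of "I \<inter> I'" x] that g(3) g'(3) by blast
        then have "f x = h x" if "x \<in> X" for x using g(5) g'(5) that by metis
        moreover have "f \<in> X \<rightarrow>\<^sub>E Y" "h \<in> X \<rightarrow>\<^sub>E Y" using fh by (auto simp: E_def End_omega_def)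
        ultimately show "f = h" by (intro PiE_ext)
      qed
      ultimately show ?thesis by (rule countable_image_inj_on)
    qed simp
  qed
  moreover have "End_omega X Y \<subseteq> (\<Union>j\<in>J. E j)"
  proof
    fix f assume f: "f \<in> End_omega X Y"
    then obtain I g where I: "open I" "is_interval I" "X \<subseteq> I" "g real_analytic_on I" "\<forall>x\<in>X. g x = f x"
      and "f ` X = Y" unfolding End_omega_def by blast
    then have img: "g ` X = Y" by auto
    have con: "connected I" using I(2) by (simp add: is_interval_connected_1)
    obtain \<sigma> p q r s F where "\<sigma> \<in> {-1, 1}" "p \<in> \<rat> - X" "q \<in> \<rat> - X" "r \<in> \<rat>" "s \<in> \<rat>"
      "X \<inter> {p..q} \<noteq> {}" "strict_mono_on (X \<inter> {p..q}) (\<lambda>x. \<sigma> * g x)" "g ` (X \<inter> {p..q}) = Y \<inter> {r..s}"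
      "(\<lambda>t. \<sigma> * g (Inf (X \<inter> {p..q}) + t)) has_fps_expansion F" "0 < fps_nth F 1"
      using monotone_piece[OF assms I(1) con I(3,4) img] by metis
    then have "R (\<sigma>, p, q, r, s) f F" "(\<sigma>, p, q, r, s) \<in> J"
      using I con unfolding R_def J_def prod.case by blast+
    then show "f \<in> (\<Union>j\<in>J. E j)" using f unfolding E_def by blast
  qed
  ultimately show ?thesis by (meson countable_UN countable_subset)
qed

end
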